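(* Let $\alpha>-1$ and let $u\in TS_{H_{\alpha}}$ have the expansion $$u(z)=\sum_{k=0}^{\infty}c_{k}z^{k}+\sum_{k=1}^{\infty}c_{-k}P_{\alpha,k}(|z|^{2})\bar{z}^{k},\quad z\in\mathbb{D}.$$ Suppose that one of the following two conditions is satisfied: (1) $\alpha\in[0,+\infty)$; (2) $\alpha\in(-1,0)$ and $|c_{-1}|<1+\alpha$. Then for every $k=2,3,4,\ldots$, $$\left|\frac{c_{k}-c_{-k}B(k,\alpha+1)}{1-c_{-1}B(1,\alpha+1)}\right|\leq k,$$ where $B(\cdot,\cdot)$ is the Beta function.
   Context: $\mathbb{D}$ is the open unit disk in $\mathbb{C}$. For $\alpha>-1$, a complex-valued kernel $\alpha$-harmonic mapping is a function $u\in\mathcal{C}^{2}(\mathbb{D})$, $u:\mathbb{D}\to\mathbb{C}$, satisfying $\frac{\partial}{\partial z}\left((1-|z|^{2})^{-\alpha}\frac{\partial u}{\partial\bar z}\right)=0$ in $\mathbb{D}$. It is known that these are exactly the functions given by a convergent expansion $u(z)=\sum_{k=0}^{\infty}c_{k}z^{k}+\sum_{k=1}^{\infty}c_{-k}P_{\alpha,k}(|z|^{2})\bar{z}^{k}$ with complex coefficients $\{c_k\}_{k\in\mathbb{Z}}$ satisfying $\limsup_{|k|\to\infty}|c_{k}|^{1/|k|}\le 1$, where $P_{\alpha,k}(x)=\int_{0}^{1}t^{k-1}(1-tx)^{\alpha}\,dt$ for $-1<x<1$. Such a mapping $u$, not identically constant, is called sense-preserving at $z_{0}\in\mathbb{D}$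 if $u_{z}\not\equiv 0$, the function $\omega:=(\overline{u})_{z}/u_{z}$ is well defined at $z_{0}$ (possibly with a removable singularity), and $|\omega(z_{0})|<1$; it is sense-preserving in $\mathbb{D}$ if it is sense-preserving at every point of $\mathbb{D}$. $S_{H_{\alpha}}$ is the class of complex-valued kernel $\alpha$-harmonic mappings $u$ that are univalent (injective) and sense-preserving in $\mathbb{D}$ and satisfy the normalization $u(0)=0$ and $c_{1}=1$. $TS_{H_{\alpha}}$ is the subclass of those $u\in S_{H_{\alpha}}$ for which all the coefficients $c_{k}$ and $c_{-k}$ are real numbers. *)

theory Defs
  imports "HOL-Analysis.Analysis"
begin

abbreviation unit_disk :: "complex set" where
  "unit_disk \<equiv> ball 0 1"

text \<open>\<open>C_k_on n f S\<close> is meant for open sets \<open>S\<close>: \<open>f\<close> is \<open>n\<close> times continuously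
  differentiable on \<open>S\<close> in the real sense.\<close>

primrec C_k_on :: "nat \<Rightarrow> ('a::real_normed_vector \<Rightarrow> 'b::real_normed_vector) \<Rightarrow> 'a set \<Rightarrow> bool" where
  "C_k_on 0 f S \<longleftrightarrow> continuous_on S f"
| "C_k_on (Suc n) f S \<longleftrightarrow>
     (\<forall>x\<in>S. f differentiable (at x)) \<and>
     (\<forall>v. C_k_on n (\<lambda>x. frechet_derivative f (at x) v) S)"

text \<open>The Wirtinger derivatives \<open>(u\<^sub>x - \<i> u\<^sub>y) / 2\<close> and \<open>(u\<^sub>x + \<i> u\<^sub>y) / 2\<close>: the partial
  derivatives are the values of the real derivative in the directions \<open>1\<close> and \<open>\<i>\<close>.\<close>

definition wirtinger_dz :: "(complex \<Rightarrow> complex) \<Rightarrow> complex \<Rightarrow> complex" where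
  "wirtinger_dz u z =
     (frechet_derivative u (at z) 1 - \<i> * frechet_derivative u (at z) \<i>) / 2"

definition wirtinger_dzbar :: "(complex \<Rightarrow> complex) \<Rightarrow> complex \<Rightarrow> complex" where
  "wirtinger_dzbar u z =
     (frechet_derivative u (at z) 1 + \<i> * frechet_derivative u (at z) \<i>) / 2"

definition kernel_harmonic :: "real \<Rightarrow> (complex \<Rightarrow> complex) \<Rightarrow> bool" where
  "kernel_harmonic \<alpha> u \<longleftrightarrow>
     C_k_on 2 u unit_disk \<and>
     (\<forall>z\<in>unit_disk.
        wirtinger_dz
          (\<lambda>w. of_real ((1 - (cmod w)\<^sup>2) powr (- \<alpha>)) * wirtinger_dzbar u w) z = 0)"

definition kernel_P :: "real \<Rightarrow> nat \<Rightarrow> real \<Rightarrow> real" where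
  "kernel_P \<alpha> k x = integral {0..1} (\<lambda>t. t ^ (k - 1) * (1 - t * x) powr \<alpha>)"

text \<open>The filter \<open>filtercomap abs at_top\<close> on the integers is \<open>\<bar>k\<bar> \<rightarrow> \<infinity>\<close>.  The second
  series starts at \<open>k = 1\<close> and is therefore indexed by \<open>k = Suc n\<close>.\<close>

definition kernel_expansion ::
    "real \<Rightarrow> (complex \<Rightarrow> complex) \<Rightarrow> (int \<Rightarrow> complex) \<Rightarrow> bool" where
  "kernel_expansion \<alpha> u c \<longleftrightarrow>
     Limsup (filtercomap abs at_top)
       (\<lambda>k::int. ereal (root (nat \<bar>k\<bar>) (cmod (c k)))) \<le> 1 \<and>
     (\<forall>z\<in>unit_disk.
        summable (\<lambda>k. c (int k) * z ^ k) \<and>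
        summable (\<lambda>n. c (- int (Suc n)) * of_real (kernel_P \<alpha> (Suc n) ((cmod z)\<^sup>2))
                        * cnj z ^ Suc n) \<and>
        u z = (\<Sum>k. c (int k) * z ^ k) +
              (\<Sum>n. c (- int (Suc n)) * of_real (kernel_P \<alpha> (Suc n) ((cmod z)\<^sup>2))
                        * cnj z ^ Suc n))"

definition dilatation_quotient :: "(complex \<Rightarrow> complex) \<Rightarrow> complex \<Rightarrow> complex" where
  "dilatation_quotient u z = wirtinger_dz (\<lambda>w. cnj (u w)) z / wirtinger_dz u z"

text \<open>The quotient is well defined at \<open>z\<close> if its denominator does not vanish there, or if
  \<open>z\<close> is an isolated zero of the denominator at which the quotient has a finite limit
  (a removable singularity); in the latter case its value at \<open>z\<close> is that limit.\<close>

definition dilatation_well_defined_at :: "(complex \<Rightarrow> complex) \<Rightarrow> complex \<Rightarrow> bool" where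
  "dilatation_well_defined_at u z \<longleftrightarrow>
     wirtinger_dz u z \<noteq> 0 \<or>
     ((\<forall>\<^sub>F w in at z. wirtinger_dz u w \<noteq> 0) \<and>
      (\<exists>l. (dilatation_quotient u \<longlongrightarrow> l) (at z)))"

definition dilatation :: "(complex \<Rightarrow> complex) \<Rightarrow> complex \<Rightarrow> complex" where
  "dilatation u z =
     (if wirtinger_dz u z \<noteq> 0 then dilatation_quotient u z
      else Lim (at z) (dilatation_quotient u))"

definition sense_preserving_at :: "(complex \<Rightarrow> complex) \<Rightarrow> complex \<Rightarrow> bool" where
  "sense_preserving_at u z \<longleftrightarrow>
     \<not> u constant_on unit_disk \<and>
     (\<exists>w\<in>unit_disk. wirtinger_dz u w \<noteq> 0) \<and>
     dilatation_well_defined_at u z \<and>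
     cmod (dilatation u z) < 1"

text \<open>The coefficients of an expansion are uniquely determined by \<open>u\<close>, so the existential
  quantifiers below select the coefficient sequence of \<open>u\<close>.\<close>

definition S_H :: "real \<Rightarrow> (complex \<Rightarrow> complex) set" where
  "S_H \<alpha> = {u. kernel_harmonic \<alpha> u \<and> inj_on u unit_disk \<and>
               (\<forall>z\<in>unit_disk. sense_preserving_at u z) \<and>
               u 0 = 0 \<and> (\<exists>c. kernel_expansion \<alpha> u c \<and> c 1 = 1)}"

definition TS_H :: "real \<Rightarrow> (complex \<Rightarrow> complex) set" where
  "TS_H \<alpha> = {u \<in> S_H \<alpha>. \<exists>c. kernel_expansion \<alpha> u c \<and> (\<forall>k. c k \<in> \<real>)}"

end

theory Submission
  imports Defs
begin

text \<open>Since the coefficients are real, \<open>u\<close> commutes with conjugation, so by injectivity \<open>u\<close> is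
  non-real off the real axis and \<open>Im u\<close> has constant sign on the upper half-disk.  On the circle
  of radius \<open>r\<close> the \<open>k\<close>-th sine coefficient of \<open>Im u\<close> is \<open>D\<^sub>k = c\<^sub>k r\<^sup>k - c\<^sub>-\<^sub>k P\<^sub>k(r\<^sup>2) r\<^sup>k\<close>;
  the inequality \<open>\<bar>sin k\<theta>\<bar> \<le> k \<bar>sin \<theta>\<bar>\<close> and the constant sign of \<open>Im u \<cdot> sin \<theta>\<close> give
  \<open>\<bar>D\<^sub>k\<bar> \<le> k \<bar>D\<^sub>1\<bar>\<close>, and \<open>P\<^sub>k(r\<^sup>2)\<close> tends to \<open>B(k, \<alpha> + 1)\<close> as \<open>r \<rightarrow> 1\<close>.\<close>

section \<open>The kernel integrals \<open>kernel_P\<close> and their Beta limit\<close>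

text \<open>The power is monotone in \<open>s\<close>, so its largest value on [0, x] is at an
  endpoint: 1 for \<alpha> \<ge> 0, the value at \<open>x\<close> otherwise. Adding the two serves
  every sign of \<alpha>. With \<open>x\<close> fixed this bounds the integrand of
  \<open>kernel_P\<close>; with \<open>x\<close> the integration variable it gives a majorant for a
  limit.\<close>

lemma kernel_weight_le:
  fixes \<alpha> s x :: real
  assumes "0 \<le> s" "s \<le> x" "x < 1"
  shows "(1 - s) powr \<alpha> \<le> 1 + (1 - x) powr \<alpha>"
proof (cases "\<alpha> \<ge> 0")
  case True
  have "(1 - s) powr \<alpha> \<le> 1 powr \<alpha>"
    using assms True by (intro powr_mono2) auto
  then show ?thesis by (simp add: add_increasing2)
next
  case False
  have "(1 - s) powr \<alpha> \<le> (1 - x) powr \<alpha>"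
    using assms False by (intro powr_mono2') auto
  then show ?thesis by simp
qed

lemma kernel_integrand_continuous:
  fixes x :: real
  assumes "0 \<le> x" "x < 1"
  shows "continuous_on {0..1} (\<lambda>t. t ^ (k - 1) * (1 - t * x) powr \<alpha>)"
proof -
  have "t * x < 1" if "t \<in> {0..1}" for t
    using that assms by (metis atLeastAtMost_iff le_less_trans mult_left_le_one_le)
  then show ?thesis
    by (intro continuous_intros) force
qed

text \<open>The bound is uniform in \<open>k\<close>, so on a fixed circle the kernel factors do not
  disturb absolute convergence.\<close>

lemma kernel_P_bound:
  assumes "0 \<le> x" "x < 1"
  shows "\<bar>kernel_P \<alpha> k x\<bar> \<le> 1 + (1 - x) powr \<alpha>"
proof -
  have "norm (integral {0..1} (\<lambda>t. t ^ (k - 1) * (1 - t * x) powr \<alpha>))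
          \<le> (1 + (1 - x) powr \<alpha>) * (1 - 0)"
  proof (rule integral_bound)
    fix t :: real
    assume t: "t \<in> {0..1}"
    have "(1 - t * x) powr \<alpha> \<le> 1 + (1 - x) powr \<alpha>"
      using t assms by (intro kernel_weight_le) (auto simp: mult_left_le_one_le)
    moreover have "t ^ (k - 1) \<le> 1"
      using t by (auto intro: power_le_one)
    ultimately have "t ^ (k - 1) * (1 - t * x) powr \<alpha> \<le> 1 * (1 + (1 - x) powr \<alpha>)"
      using t by (intro mult_mono) auto
    then show "norm (t ^ (k - 1) * (1 - t * x) powr \<alpha>) \<le> 1 + (1 - x) powr \<alpha>"
      using t by (simp add: abs_mult)
  qed (use kernel_integrand_continuous[OF assms] in auto)
  then show ?thesis
    by (simp add: kernel_P_def)
qed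

text \<open>Dominated convergence: since \<alpha> > -1, the majorant 1 + (1 - t)^\<alpha> is
  integrable on (0, 1).\<close>

lemma kernel_P_tendsto_Beta:
  assumes "\<alpha> > -1" "k \<ge> 1" and X: "\<And>n. 0 \<le> X n" "\<And>n. X n < 1" "X \<longlonglongrightarrow> 1"
  shows "(\<lambda>n. kernel_P \<alpha> k (X n)) \<longlonglongrightarrow> Beta (real k) (\<alpha> + 1)"
proof -
  define f where "f n t = t ^ (k - 1) * (1 - t * X n) powr \<alpha>" for n t
  define g :: "real \<Rightarrow> real" where "g t = t ^ (k - 1) * (1 - t) powr \<alpha>" for t
  \<comment> \<open>The factor \<open>t powr (1 - 1)\<close> makes the second summand the integrand of \<open>Beta 1 (\<alpha> + 1)\<close>.\<close>
  define h :: "real \<Rightarrow> real" where "h t = 1 + t powr (1 - 1) * (1 - t) powr \<alpha>" for t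
  \<comment> \<open>The open interval avoids two bad endpoints: at 0 with \<open>k = 1\<close>,
    \<open>0 powr 0 = 0\<close> but \<open>0 ^ 0 = 1\<close>; at 1 with \<alpha> < 0,
    \<open>0 powr \<alpha> = 0\<close> while the integrands are unbounded in
    \<open>n\<close>.\<close>
  have g: "(g has_integral Beta (real k) (\<alpha> + 1)) {0<..<1}"
  proof -
    have "((\<lambda>t. t powr (real k - 1) * (1 - t) powr (\<alpha> + 1 - 1))
            has_integral Beta (real k) (\<alpha> + 1)) {0<..<1}"
      using has_integral_Beta_real[of "real k" "\<alpha> + 1"] assms
      by (simp add: has_integral_Icc_iff_Ioo)
    then show ?thesis
    proof (rule has_integral_eq[rotated])
      fix t :: real
      assume "t \<in> {0<..<1}"
      then show "t powr (real k - 1) * (1 - t) powr (\<alpha> + 1 - 1) = g t"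
        using assms(2) powr_realpow[of t "k - 1"] by (simp add: g_def of_nat_diff)
    qed
  qed
  have "(\<lambda>n. integral {0<..<1} (f n)) \<longlonglongrightarrow> integral {0<..<1} g"
  proof (rule dominated_convergence(2))
    show "f n integrable_on {0<..<1}" for n
      unfolding f_def integrable_on_Icc_iff_Ioo[symmetric]
      using kernel_integrand_continuous[OF X(1,2)] integrable_continuous_real by blast
    have "(\<lambda>t. t powr (1 - 1) * (1 - t) powr \<alpha>) integrable_on {0<..<1::real}"
      using has_integral_Beta_real[of 1 "\<alpha> + 1"] assms(1)
      by (auto simp: has_integral_Icc_iff_Ioo integrable_on_def)
    moreover have "(\<lambda>t. 1::real) integrable_on {0<..<1::real}"
      using integrable_const_ivl[of "1::real" "0::real" 1] by (simp only: integrable_on_Icc_iff_Ioo)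
    ultimately show "h integrable_on {0<..<1}"
      unfolding h_def by (rule integrable_add[rotated])
    show "norm (f n t) \<le> h t" if t: "t \<in> {0<..<1}" for n t
    proof -
      have "(1 - t * X n) powr \<alpha> \<le> 1 + (1 - t) powr \<alpha>"
        using t X(1,2)[of n] by (intro kernel_weight_le) (auto simp: mult_left_le)
      moreover have "t ^ (k - 1) \<le> 1"
        using t by (auto intro: power_le_one)
      ultimately have "t ^ (k - 1) * (1 - t * X n) powr \<alpha> \<le> 1 * (1 + (1 - t) powr \<alpha>)"
        using t by (intro mult_mono) auto
      then show ?thesis
        using t by (simp add: f_def h_def abs_mult)
    qed
    show "(\<lambda>n. f n t) \<longlonglongrightarrow> g t" if t: "t \<in> {0<..<1}" for t
    proof -
      have "(\<lambda>n. t ^ (k - 1) * (1 - t * X n) powr \<alpha>) \<longlonglongrightarrow> t ^ (k - 1) * (1 - t * 1) powr \<alpha>"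
        using t by (intro tendsto_intros X) auto
      then show ?thesis
        by (simp add: f_def g_def)
    qed
  qed
  moreover have "integral {0<..<1} (f n) = kernel_P \<alpha> k (X n)" for n
    by (simp add: f_def[abs_def] kernel_P_def integral_open_interval_real)
  ultimately show ?thesis
    using integral_unique[OF g] by simp
qed

section \<open>Fourier coefficients on circles\<close>

lemma cis_has_integral_period:
  fixes n :: int
  shows "((\<lambda>\<theta>. cis (of_int n * \<theta>)) has_integral (if n = 0 then 2 * of_real pi else 0)) {-pi..pi}"
proof (cases "n = 0")
  case True
  then show ?thesis
    using has_integral_const_real[of "1::complex" "-pi" pi] by (simp add: scaleR_conv_of_real)
next
  case False
  let ?G = "\<lambda>\<theta>. cis (of_int n * \<theta>) / (\<i> * of_int n)"
  have "((\<lambda>\<theta>. cis (of_int n * \<theta>)) has_integral ?G pi - ?G (-pi)) {-pi..pi}"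
  proof (rule fundamental_theorem_of_calculus)
    fix \<theta> :: real
    have "((\<lambda>z. exp (\<i> * of_int n * z) / (\<i> * of_int n)) has_field_derivative
            exp (\<i> * of_int n * of_real \<theta>)) (at (of_real \<theta>))"
      using False by (auto intro!: derivative_eq_intros)
    from has_vector_derivative_real_field[OF this]
    show "(?G has_vector_derivative cis (of_int n * \<theta>)) (at \<theta> within {-pi..pi})"
      by (simp add: cis_conv_exp mult.assoc)
  qed auto
  moreover have "sin (of_int n * pi) = 0"
    by (metis mult.commute sin_integer_2pi sin_npi_int)
  then have "cis (of_int n * pi) = cis (of_int n * - pi)"
    by (simp add: complex_eq_iff)
  ultimately show ?thesis
    using False by simp
qed

text \<open>Absolute summability gives uniform convergence, hence termwise integration. The
  frequencies \<open>m\<close> are arbitrary so that the analytic and the conjugate series, each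
  multiplied by exp(-ij\<theta>), are both covered.\<close>

lemma trigonometric_series_has_integral:
  fixes a :: "nat \<Rightarrow> complex" and m :: "nat \<Rightarrow> int"
  assumes "summable (\<lambda>n. norm (a n))"
  shows "((\<lambda>\<theta>. \<Sum>n. a n * cis (of_int (m n) * \<theta>)) has_integral
           2 * of_real pi * (\<Sum>n. if m n = 0 then a n else 0)) {-pi..pi}"
proof -
  have "uniform_limit {-pi..pi} (\<lambda>N \<theta>. \<Sum>n<N. a n * cis (of_int (m n) * \<theta>))
          (\<lambda>\<theta>. \<Sum>n. a n * cis (of_int (m n) * \<theta>)) sequentially"
    by (rule Weierstrass_m_test[OF _ assms]) (simp add: norm_mult)
  moreover have "continuous_on {-pi..pi} (\<lambda>\<theta>. \<Sum>n<N. a n * cis (of_int (m n) * \<theta>))" for N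
    by (intro continuous_intros)
  ultimately obtain I J where I: "\<And>N. ((\<lambda>\<theta>. \<Sum>n<N. a n * cis (of_int (m n) * \<theta>)) has_integral I N) {-pi..pi}"
    and J: "((\<lambda>\<theta>. \<Sum>n. a n * cis (of_int (m n) * \<theta>)) has_integral J) {-pi..pi}"
    and lim: "I \<longlonglongrightarrow> J"
    using uniform_limit_integral[OF _ _ sequentially_bot] by blast
  have "((\<lambda>\<theta>. \<Sum>n<N. a n * cis (of_int (m n) * \<theta>)) has_integral
          (\<Sum>n<N. a n * (if m n = 0 then 2 * of_real pi else 0))) {-pi..pi}" for N
    by (intro has_integral_sum has_integral_mult_right cis_has_integral_period) auto
  then have "I N = (\<Sum>n<N. a n * (if m n = 0 then 2 * of_real pi else 0))" for N
    using I has_integral_unique by blast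
  then have I_eq: "I N = 2 * of_real pi * (\<Sum>n<N. if m n = 0 then a n else 0)" for N
    by (auto simp: sum_distrib_left intro!: sum.cong)
  have "summable (\<lambda>n. if m n = 0 then a n else 0)"
    by (rule summable_comparison_test'[OF assms]) auto
  then have "I \<longlonglongrightarrow> 2 * of_real pi * (\<Sum>n. if m n = 0 then a n else 0)"
    unfolding I_eq by (intro tendsto_intros summable_LIMSEQ)
  then show ?thesis
    using J lim LIMSEQ_unique by blast
qed

text \<open>Root test: for 1 < q < 1/r the coefficients are eventually at most q^|k|, and qr <
  1.\<close>

lemma kernel_expansion_coeff_summable:
  assumes "kernel_expansion \<alpha> u c" "0 < r" "r < 1"
  shows "summable (\<lambda>n. cmod (c (int n)) * r ^ n)"
    and "summable (\<lambda>n. cmod (c (- int (Suc n))) * r ^ Suc n)"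
proof -
  obtain q where q: "1 < q" "q < 1 / r"
    using dense[of 1 "1 / r"] assms by auto
  have "Limsup (filtercomap abs at_top)
       (\<lambda>k::int. ereal (root (nat \<bar>k\<bar>) (cmod (c k)))) < ereal q"
    using assms(1) q(1) unfolding kernel_expansion_def by (auto elim: le_less_trans)
  then have "\<forall>\<^sub>F k::int in filtercomap abs at_top. ereal (root (nat \<bar>k\<bar>) (cmod (c k))) < ereal q"
    by (rule Limsup_lessD)
  then obtain N :: int where N: "\<And>k. \<bar>k\<bar> \<ge> N \<Longrightarrow> root (nat \<bar>k\<bar>) (cmod (c k)) < q"
    unfolding eventually_filtercomap eventually_at_top_linorder by auto
  \<comment> \<open>The index 0 is excluded because \<open>root 0 x = 0\<close> says nothing about
    \<open>c 0\<close>.\<close>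
  have bound: "cmod (c k) \<le> q ^ nat \<bar>k\<bar>" if "\<bar>k\<bar> \<ge> N" "k \<noteq> 0" for k
  proof -
    have "cmod (c k) = root (nat \<bar>k\<bar>) (cmod (c k)) ^ nat \<bar>k\<bar>"
      using that by (simp add: real_root_pow_pos2)
    also have "\<dots> \<le> q ^ nat \<bar>k\<bar>"
      using N[OF that(1)] by (intro power_mono) (auto intro: less_imp_le real_root_ge_zero)
    finally show ?thesis .
  qed
  have "norm (q * r) < 1"
    using q assms by (simp add: abs_mult field_simps)
  then have geo: "summable (\<lambda>n. (q * r) ^ n)"
    by (rule summable_geometric)
  show "summable (\<lambda>n. cmod (c (int n)) * r ^ n)"
  proof (rule summable_comparison_test'[OF geo])
    fix n
    assume "n \<ge> nat (max N 1)"
    then show "norm (cmod (c (int n)) * r ^ n) \<le> (q * r) ^ n"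
      using bound[of "int n"] assms(2) by (simp add: power_mult_distrib nat_le_iff)
  qed
  have "summable (\<lambda>n. (q * r) ^ Suc n)"
    using geo by (subst summable_Suc_iff)
  then show "summable (\<lambda>n. cmod (c (- int (Suc n))) * r ^ Suc n)"
  proof (rule summable_comparison_test')
    fix n
    assume "n \<ge> nat (max N 1)"
    then have "cmod (c (- int (Suc n))) \<le> q ^ nat \<bar>- int (Suc n)\<bar>"
      by (intro bound) auto
    then have "cmod (c (- int (Suc n))) \<le> q ^ Suc n"
      by (simp only: abs_minus_cancel abs_of_nat nat_int)
    then show "norm (cmod (c (- int (Suc n))) * r ^ Suc n) \<le> (q * r) ^ Suc n"
      using assms(2) unfolding power_mult_distrib by (simp add: abs_mult mult_right_mono)
  qed
qed

text \<open>The \<open>j\<close>-th Fourier coefficient of \<open>\<theta> \<mapsto> u (r * cis \<theta>)\<close>, read off the expansion of \<open>u\<close>.\<close>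

definition circle_coeff :: "real \<Rightarrow> (int \<Rightarrow> complex) \<Rightarrow> real \<Rightarrow> int \<Rightarrow> complex" where
  "circle_coeff \<alpha> c r j =
     c j * of_real (r ^ nat \<bar>j\<bar>) * (if j \<ge> 0 then 1 else of_real (kernel_P \<alpha> (nat (- j)) (r\<^sup>2)))"

text \<open>On |z| = r the factors \<open>kernel_P\<close> do not depend on the angle, so both
  series become absolutely convergent trigonometric series.\<close>

lemma kernel_expansion_fourier:
  assumes "kernel_expansion \<alpha> u c" "0 < r" "r < 1"
  shows "((\<lambda>\<theta>. u (of_real r * cis \<theta>) * cis (- (of_int j * \<theta>))) has_integral
           2 * of_real pi * circle_coeff \<alpha> c r j) {-pi..pi}"
proof -
  define a where "a n = c (int n) * of_real r ^ n" for n
  define b where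
    "b n = c (- int (Suc n)) * of_real (kernel_P \<alpha> (Suc n) (r\<^sup>2)) * of_real r ^ Suc n" for n
  have sa: "summable (\<lambda>n. norm (a n))"
    using kernel_expansion_coeff_summable(1)[OF assms] assms(2)
    by (simp add: a_def norm_mult norm_power)
  have r2: "r\<^sup>2 < 1"
    using assms by (simp add: power_less_one_iff)
  have sb: "summable (\<lambda>n. norm (b n))"
  proof (rule summable_comparison_test')
    show "summable (\<lambda>n. (1 + (1 - r\<^sup>2) powr \<alpha>) * (cmod (c (- int (Suc n))) * r ^ Suc n))"
      by (intro summable_mult kernel_expansion_coeff_summable(2)[OF assms])
    fix n :: nat
    assume "n \<ge> 0"
    have "cmod (c (- int (Suc n))) * r ^ Suc n * \<bar>kernel_P \<alpha> (Suc n) (r\<^sup>2)\<bar>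
        \<le> cmod (c (- int (Suc n))) * r ^ Suc n * (1 + (1 - r\<^sup>2) powr \<alpha>)"
      using assms r2 by (intro mult_left_mono kernel_P_bound) auto
    then show "norm (norm (b n))
        \<le> (1 + (1 - r\<^sup>2) powr \<alpha>) * (cmod (c (- int (Suc n))) * r ^ Suc n)"
      using assms unfolding b_def norm_mult norm_power norm_of_real
      by (simp add: abs_mult mult_ac)
  qed
  have u_eq: "u (of_real r * cis \<theta>) * cis (- (of_int j * \<theta>)) =
      (\<Sum>n. a n * cis (of_int (int n - j) * \<theta>)) + (\<Sum>n. b n * cis (of_int (- int (Suc n) - j) * \<theta>))"
    for \<theta>
  proof -
    define z where "z = of_real r * cis \<theta>"
    have cz: "cmod z = r"
      using assms by (simp add: z_def norm_mult)
    then have "z \<in> unit_disk"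
      using assms by simp
    then have s1: "summable (\<lambda>k. c (int k) * z ^ k)"
      and s2: "summable (\<lambda>n. c (- int (Suc n)) * of_real (kernel_P \<alpha> (Suc n) ((cmod z)\<^sup>2))
                        * cnj z ^ Suc n)"
      and uz: "u z = (\<Sum>k. c (int k) * z ^ k) +
              (\<Sum>n. c (- int (Suc n)) * of_real (kernel_P \<alpha> (Suc n) ((cmod z)\<^sup>2))
                        * cnj z ^ Suc n)"
      using assms(1) unfolding kernel_expansion_def by blast+
    have t1: "c (int n) * z ^ n * cis (- (of_int j * \<theta>)) = a n * cis (of_int (int n - j) * \<theta>)" for n
      unfolding a_def z_def power_mult_distrib Complex.DeMoivre mult.assoc cis_mult
      by (simp add: algebra_simps)
    have cnj_z: "cnj z = of_real r * cis (- \<theta>)"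
      by (simp add: z_def cis_cnj)
    have t2: "c (- int (Suc n)) * of_real (kernel_P \<alpha> (Suc n) ((cmod z)\<^sup>2)) * cnj z ^ Suc n
          * cis (- (of_int j * \<theta>)) = b n * cis (of_int (- int (Suc n) - j) * \<theta>)" for n
      unfolding cz cnj_z b_def power_mult_distrib Complex.DeMoivre mult.assoc cis_mult
      by (simp add: algebra_simps)
    show ?thesis
      unfolding z_def[symmetric] uz distrib_right suminf_mult2[OF s1] suminf_mult2[OF s2] t1 t2 ..
  qed
  \<comment> \<open>Only one frequency vanishes: index j of the first series if j \<ge> 0, index -j
    - 1 of the second if j < 0.\<close>
  have "(\<Sum>n. if int n - j = 0 then a n else 0) + (\<Sum>n. if - int (Suc n) - j = 0 then b n else 0)
      = circle_coeff \<alpha> c r j"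
  proof (cases "j \<ge> 0")
    case True
    then obtain m where m: "j = int m"
      using nonneg_int_cases by blast
    have "(\<Sum>n. if int n - j = 0 then a n else 0) = a m"
      using suminf_finite[of "{m}" "\<lambda>n. if int n - j = 0 then a n else 0"] m by simp
    moreover have "- int (Suc n) - j \<noteq> 0" for n
      using True by auto
    ultimately show ?thesis
      using m by (simp add: circle_coeff_def a_def)
  next
    case False
    then obtain m where m: "j = - int (Suc m)"
      by (metis int_cases linorder_not_le of_nat_0_le_iff)
    have "(\<Sum>n. if - int (Suc n) - j = 0 then b n else 0) = b m"
      using suminf_finite[of "{m}" "\<lambda>n. if - int (Suc n) - j = 0 then b n else 0"] m by simp
    moreover have "int n - j \<noteq> 0" for n
      using False by auto
    moreover have "nat \<bar>j\<bar> = Suc m" "nat (- j) = Suc m"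
      using m by auto
    ultimately show ?thesis
      using m False by (simp add: circle_coeff_def b_def mult_ac)
  qed
  then show ?thesis
    unfolding u_eq
    using has_integral_add[OF trigonometric_series_has_integral[OF sa, of "\<lambda>n. int n - j"]
       trigonometric_series_has_integral[OF sb, of "\<lambda>n. - int (Suc n) - j"]]
    by (simp only: distrib_left[symmetric])
qed

text \<open>Both sides are the same Fourier integral of \<open>u\<close>. This transfers facts
  between different coefficient sequences of \<open>u\<close>.\<close>

lemma circle_coeff_unique:
  assumes "kernel_expansion \<alpha> u c" "kernel_expansion \<alpha> u d" "0 < r" "r < 1"
  shows "circle_coeff \<alpha> c r j = circle_coeff \<alpha> d r j"
  using has_integral_unique[OF kernel_expansion_fourier[OF assms(1,3,4)]
      kernel_expansion_fourier[OF assms(2,3,4)]]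
  by simp

section \<open>The sine inequality and the sign of the imaginary part\<close>

lemma abs_sin_multiple_le: "\<bar>sin (real k * x)\<bar> \<le> real k * \<bar>sin x\<bar>"
proof (induction k)
  case (Suc k)
  have "\<bar>sin (real (Suc k) * x)\<bar> = \<bar>sin (real k * x) * cos x + cos (real k * x) * sin x\<bar>"
    by (simp only: of_nat_Suc distrib_right mult_1 add.commute[of 1] sin_add)
  also have "\<dots> \<le> \<bar>sin (real k * x)\<bar> * \<bar>cos x\<bar> + \<bar>cos (real k * x)\<bar> * \<bar>sin x\<bar>"
    by (metis abs_mult abs_triangle_ineq)
  also have "\<dots> \<le> \<bar>sin (real k * x)\<bar> * 1 + 1 * \<bar>sin x\<bar>"
    by (intro add_mono mult_left_mono mult_right_mono) auto
  finally show ?case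
    using Suc by (simp add: distrib_right)
qed simp

lemma kernel_expansion_cnj:
  assumes "kernel_expansion \<alpha> u c" "\<And>k. c k \<in> \<real>" "z \<in> unit_disk"
  shows "u (cnj z) = cnj (u z)"
proof -
  have c: "cnj (c k) = c k" for k
    using assms(2) by (simp add: Reals_cnj_iff)
  have cnj_suminf: "cnj (suminf f) = (\<Sum>n. cnj (f n))" if "summable f" for f :: "nat \<Rightarrow> complex"
    using bounded_linear.suminf[OF bounded_linear_cnj that] .
  have "cnj z \<in> unit_disk"
    using assms(3) by simp
  then show ?thesis
    using assms(1,3) unfolding kernel_expansion_def by (simp add: cnj_suminf c)
qed

text \<open>The upper half-disk is convex, and a real value \<open>u z\<close> there would equal
  \<open>u (cnj z)\<close>, against injectivity; so \<open>Im u\<close> keeps one sign on it.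
  Multiplying by \<open>Im z\<close> extends this to the whole disk: both factors change sign under
  conjugation, and the product is 0 on the real axis.\<close>

lemma Im_constant_sign:
  assumes cont: "continuous_on unit_disk u" and inj: "inj_on u unit_disk"
    and sym: "\<And>z. z \<in> unit_disk \<Longrightarrow> u (cnj z) = cnj (u z)"
  obtains \<sigma> :: real where "\<bar>\<sigma>\<bar> = 1"
    "\<And>z. z \<in> unit_disk \<Longrightarrow> \<bar>Im (u z)\<bar> * \<bar>Im z\<bar> = \<sigma> * (Im (u z) * Im z)"
proof -
  define H where "H = unit_disk \<inter> {z. Im z > 0}"
  have "connected H"
    unfolding H_def by (intro convex_connected convex_Int convex_ball convex_halfspace_Im_gt)
  moreover have "continuous_on H (\<lambda>z. Im (u z))"
    using cont by (intro continuous_intros) (auto simp: H_def intro: continuous_on_subset)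
  ultimately have conn: "connected ((\<lambda>z. Im (u z)) ` H)"
    by (rule connected_continuous_image[rotated])
  have nz: "Im (u z) \<noteq> 0" if "z \<in> H" for z
  proof
    assume "Im (u z) = 0"
    then have "u (cnj z) = u z"
      using sym[of z] that by (simp add: H_def complex_eq_iff)
    then have "cnj z = z"
      using inj that by (auto simp: H_def inj_on_def)
    then show False
      using that by (auto simp: H_def complex_eq_iff)
  qed
  then have "0 \<notin> (\<lambda>z. Im (u z)) ` H"
    by force
  then have "\<not> (Im (u z) \<le> 0 \<and> 0 \<le> Im (u w))" if "z \<in> H" "w \<in> H" for z w
    using connectedD_interval[OF conn, of "Im (u z)" "Im (u w)" 0] that by blast
  then have "(\<forall>z\<in>H. Im (u z) > 0) \<or> (\<forall>z\<in>H. Im (u z) < 0)"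
    by (meson linorder_not_le)
  then obtain \<sigma> :: real where \<sigma>: "\<bar>\<sigma>\<bar> = 1" "\<And>z. z \<in> H \<Longrightarrow> \<bar>Im (u z)\<bar> = \<sigma> * Im (u z)"
  proof (elim disjE)
    assume "\<forall>z\<in>H. Im (u z) > 0"
    then show ?thesis
      using that[of 1] by force
  next
    assume "\<forall>z\<in>H. Im (u z) < 0"
    then show ?thesis
      using that[of "-1"] by force
  qed
  have "\<bar>Im (u z)\<bar> * \<bar>Im z\<bar> = \<sigma> * (Im (u z) * Im z)" if z: "z \<in> unit_disk" for z
  proof (cases "Im z" "0::real" rule: linorder_cases)
    case less
    then have "\<bar>Im (u (cnj z))\<bar> = \<sigma> * Im (u (cnj z))"
      using z by (intro \<sigma>) (auto simp: H_def)
    then show ?thesis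
      using less sym[OF z] by simp
  next
    case greater
    then show ?thesis
      using \<sigma>(2)[of z] z by (simp add: H_def)
  qed simp
  then show ?thesis
    using that \<sigma>(1) by blast
qed

section \<open>The coefficient inequality on a circle\<close>

lemma circle_coeff_difference_bound:
  assumes ex: "kernel_expansion \<alpha> u c" and re: "\<And>k. c k \<in> \<real>"
    and cont: "continuous_on unit_disk u" and inj: "inj_on u unit_disk"
    and r: "0 < r" "r < 1"
  shows "cmod (circle_coeff \<alpha> c r (int k) - circle_coeff \<alpha> c r (- int k))
          \<le> real k * cmod (circle_coeff \<alpha> c r 1 - circle_coeff \<alpha> c r (-1))"
proof -
  define D where "D k = circle_coeff \<alpha> c r (int k) - circle_coeff \<alpha> c r (- int k)" for k
  define v where "v \<theta> = Im (u (of_real r * cis \<theta>))" for \<theta>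
  have D_real: "D k \<in> \<real>" for k
    using re by (simp add: D_def circle_coeff_def)
  have D_integral: "((\<lambda>\<theta>. v \<theta> * sin (real k * \<theta>)) has_integral pi * Re (D k)) {-pi..pi}" for k
  proof -
    \<comment> \<open>Since exp(-ik\<theta>) - exp(ik\<theta>) = -2i sin(k\<theta>), the real part
      of \<open>?e\<close> is 2 v(\<theta>) sin(k\<theta>).\<close>
    let ?e = "\<lambda>\<theta>. u (of_real r * cis \<theta>) * cis (- (of_int (int k) * \<theta>))
              - u (of_real r * cis \<theta>) * cis (- (of_int (- int k) * \<theta>))"
    have "(?e has_integral 2 * of_real pi * circle_coeff \<alpha> c r (int k)
              - 2 * of_real pi * circle_coeff \<alpha> c r (- int k)) {-pi..pi}"
      by (intro has_integral_diff kernel_expansion_fourier[OF ex r])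
    then have "((\<lambda>\<theta>. Re (?e \<theta>)) has_integral Re (2 * of_real pi * D k)) {-pi..pi}"
      unfolding D_def right_diff_distrib by (rule has_integral_Re)
    then have "((\<lambda>\<theta>. Re (?e \<theta>) / 2) has_integral Re (2 * of_real pi * D k) / 2) {-pi..pi}"
      by (rule has_integral_divide)
    then show ?thesis
      by (simp add: v_def algebra_simps)
  qed
  have disk: "of_real r * cis \<theta> \<in> unit_disk" for \<theta>
    using r by (simp add: norm_mult)
  obtain \<sigma> where \<sigma>: "\<bar>\<sigma>\<bar> = 1"
    "\<And>z. z \<in> unit_disk \<Longrightarrow> \<bar>Im (u z)\<bar> * \<bar>Im z\<bar> = \<sigma> * (Im (u z) * Im z)"
    using Im_constant_sign[OF cont inj kernel_expansion_cnj[OF ex re]] by blast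
  \<comment> \<open>Here Im z = r sin \<theta>, and the positive factor \<open>r\<close>
    cancels.\<close>
  have sign: "\<bar>v \<theta>\<bar> * \<bar>sin \<theta>\<bar> = \<sigma> * (v \<theta> * sin \<theta>)" for \<theta>
    using \<sigma>(2)[OF disk[of \<theta>]] r by (simp add: v_def abs_mult)
  have D1: "((\<lambda>\<theta>. real k * (\<sigma> * (v \<theta> * sin \<theta>))) has_integral real k * (\<sigma> * (pi * Re (D 1)))) {-pi..pi}"
    using D_integral[of 1] by (intro has_integral_mult_right) simp
  \<comment> \<open>The majorant k |v| |sin \<theta>| carries no absolute values once rewritten with
    \<sigma>, so its integral is again a multiple of \<open>D 1\<close>.\<close>
  have "norm (integral {-pi..pi} (\<lambda>\<theta>. v \<theta> * sin (real k * \<theta>)))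
      \<le> integral {-pi..pi} (\<lambda>\<theta>. real k * (\<sigma> * (v \<theta> * sin \<theta>)))"
  proof (rule integral_norm_bound_integral)
    fix \<theta>
    have "\<bar>v \<theta>\<bar> * \<bar>sin (real k * \<theta>)\<bar> \<le> \<bar>v \<theta>\<bar> * (real k * \<bar>sin \<theta>\<bar>)"
      by (intro mult_left_mono abs_sin_multiple_le) auto
    then show "norm (v \<theta> * sin (real k * \<theta>)) \<le> real k * (\<sigma> * (v \<theta> * sin \<theta>))"
      unfolding sign[symmetric] by (simp add: abs_mult mult.left_commute)
  qed (use D_integral D1 in blast)+
  then have "\<bar>pi * Re (D k)\<bar> \<le> real k * (\<sigma> * (pi * Re (D 1)))"
    using integral_unique[OF D_integral[of k]] integral_unique[OF D1]
    by (simp only: real_norm_def)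
  also have "\<dots> \<le> \<bar>real k * (\<sigma> * (pi * Re (D 1)))\<bar>"
    by simp
  also have "\<dots> = pi * (real k * \<bar>Re (D 1)\<bar>)"
    using \<sigma>(1) by (simp add: abs_mult)
  finally have "\<bar>Re (D k)\<bar> \<le> real k * \<bar>Re (D 1)\<bar>"
    by (simp add: abs_mult)
  moreover have "cmod (D k) = \<bar>Re (D k)\<bar>" for k
    using D_real[of k] by (metis Reals_cases Re_complex_of_real norm_of_real)
  ultimately have "cmod (D k) \<le> real k * cmod (D 1)"
    by simp
  then show ?thesis
    by (simp add: D_def)
qed

section \<open>Passage to the unit circle\<close>

lemma circle_coeff_difference_tendsto:
  assumes "\<alpha> > -1" "k \<ge> 1" and R: "\<And>n. 0 < R n" "\<And>n. R n < 1" "R \<longlonglongrightarrow> 1"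
  shows "(\<lambda>n. circle_coeff \<alpha> c (R n) (int k) - circle_coeff \<alpha> c (R n) (- int k))
           \<longlonglongrightarrow> c (int k) - c (- int k) * of_real (Beta (real k) (\<alpha> + 1))"
proof -
  have "(\<lambda>n. (R n)\<^sup>2) \<longlonglongrightarrow> 1"
    using tendsto_power[OF R(3), of 2] by simp
  moreover have "(R n)\<^sup>2 < 1" for n
    using R(1,2)[of n] by (simp add: power_less_one_iff)
  ultimately have "(\<lambda>n. kernel_P \<alpha> k ((R n)\<^sup>2)) \<longlonglongrightarrow> Beta (real k) (\<alpha> + 1)"
    by (intro kernel_P_tendsto_Beta assms) auto
  then have "(\<lambda>n. c (int k) * of_real (R n ^ k)
        - c (- int k) * of_real (R n ^ k) * of_real (kernel_P \<alpha> k ((R n)\<^sup>2)))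
      \<longlonglongrightarrow> c (int k) * of_real (1 ^ k)
        - c (- int k) * of_real (1 ^ k) * of_real (Beta (real k) (\<alpha> + 1))"
    by (intro tendsto_intros R)
  \<comment> \<open>As \<open>k \<ge> 1\<close>, the index \<open>- int k\<close> is negative and
    selects the \<open>kernel_P\<close> branch of \<open>circle_coeff\<close>.\<close>
  then show ?thesis
    using assms(2) by (simp add: circle_coeff_def)
qed

theorem theorem1p5:
  fixes \<alpha> :: real and u :: "complex \<Rightarrow> complex" and c :: "int \<Rightarrow> complex" and k :: nat
  assumes "\<alpha> > -1"
    and "u \<in> TS_H \<alpha>"
    and "kernel_expansion \<alpha> u c"
    and "\<alpha> \<ge> 0 \<or> (\<alpha> < 0 \<and> cmod (c (-1)) < 1 + \<alpha>)"
    and "k \<ge> 2"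
  shows "cmod ((c (int k) - c (- int k) * of_real (Beta (real k) (\<alpha> + 1)))
               / (1 - c (-1) * of_real (Beta 1 (\<alpha> + 1)))) \<le> real k"
proof -
  \<comment> \<open>The class provides real coefficients \<open>d\<close> and normalized
    coefficients \<open>e\<close> separately; uniqueness links both to the given
    \<open>c\<close>.\<close>
  obtain d where d: "kernel_expansion \<alpha> u d" "\<And>k. d k \<in> \<real>"
    using assms(2) by (auto simp: TS_H_def)
  obtain e where e: "kernel_expansion \<alpha> u e" "e 1 = 1"
    using assms(2) by (auto simp: TS_H_def S_H_def)
  have inj: "inj_on u unit_disk" and "C_k_on 2 u unit_disk"
    using assms(2) by (auto simp: TS_H_def S_H_def kernel_harmonic_def)
  then have cont: "continuous_on unit_disk u"
    by (auto simp: numeral_2_eq_2 intro!: continuous_at_imp_continuous_on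
        differentiable_imp_continuous_within)
  \<comment> \<open>At index 1 the circle coefficient is r times the coefficient, so a single radius
    suffices.\<close>
  have c1: "c 1 = 1"
    using circle_coeff_unique[OF assms(3) e(1), of "1/2" 1] e(2) by (simp add: circle_coeff_def)
  \<comment> \<open>A sequence of radii in (0, 1) tending to 1; the shift by one keeps
    \<open>R 0\<close> positive.\<close>
  define R :: "nat \<Rightarrow> real" where "R n = real (Suc n) / real (Suc (Suc n))" for n
  have R: "\<And>n. 0 < R n" "\<And>n. R n < 1"
    by (simp_all add: R_def)
  have R_lim: "R \<longlonglongrightarrow> 1"
    using LIMSEQ_Suc[OF LIMSEQ_n_over_Suc_n[where 'a=real]] by (simp add: R_def[abs_def])
  \<comment> \<open>The forms \<open>int 1\<close> and \<open>real 1\<close> make the right side the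
    case \<open>k = 1\<close> of the same limit lemma.\<close>
  have "cmod (c (int k) - c (- int k) * of_real (Beta (real k) (\<alpha> + 1)))
      \<le> real k * cmod (c (int 1) - c (- int 1) * of_real (Beta (real 1) (\<alpha> + 1)))"
  proof (rule LIMSEQ_le)
    show "(\<lambda>n. cmod (circle_coeff \<alpha> c (R n) (int k) - circle_coeff \<alpha> c (R n) (- int k)))
        \<longlonglongrightarrow> cmod (c (int k) - c (- int k) * of_real (Beta (real k) (\<alpha> + 1)))"
      using assms(1,5) by (intro tendsto_norm circle_coeff_difference_tendsto R R_lim) auto
    show "(\<lambda>n. real k * cmod (circle_coeff \<alpha> c (R n) (int 1) - circle_coeff \<alpha> c (R n) (- int 1)))
        \<longlonglongrightarrow> real k * cmod (c (int 1) - c (- int 1) * of_real (Beta (real 1) (\<alpha> + 1)))"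
      using assms(1)
      by (intro tendsto_mult_left tendsto_norm circle_coeff_difference_tendsto R R_lim) auto
    show "\<exists>N. \<forall>n\<ge>N. cmod (circle_coeff \<alpha> c (R n) (int k) - circle_coeff \<alpha> c (R n) (- int k))
        \<le> real k * cmod (circle_coeff \<alpha> c (R n) (int 1) - circle_coeff \<alpha> c (R n) (- int 1))"
      \<comment> \<open>The bound is obtained for the real sequence \<open>d\<close> and rewritten
        to \<open>c\<close> on each circle.\<close>
      using circle_coeff_difference_bound[OF d cont inj R]
      by (simp add: circle_coeff_unique[OF assms(3) d(1) R])
  qed
  then have "cmod (c (int k) - c (- int k) * of_real (Beta (real k) (\<alpha> + 1)))
      \<le> real k * cmod (1 - c (-1) * of_real (Beta 1 (\<alpha> + 1)))"
    by (simp add: c1)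
  \<comment> \<open>A vanishing denominator is harmless, since the quotient is then \<open>0\<close> by convention.\<close>
  then show ?thesis
    by (simp add: norm_divide divide_le_eq)
qed

end
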